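(* Let $X\subset\mathbb{R}^n$ be closed, bounded and convex. Let $F(x)=\mathbb{E}[\Phi(x,\xi)]$ be monotone and continuous on $X^\epsilon$, suppose there is $C>0$ with $\mathbb{E}[\|\Phi(x,\xi)\|^2]\le C^2$ for all $x\in X^\epsilon$, and suppose the solution set of VI$(X,F)$ is nonempty. Let $\xi_0,\xi_1,\dots$ be i.i.d. copies of $\xi$, independent of $x_0$. Let $\{\bar x_k(r)\}$ be generated by the aSA$_r$ algorithm with $\gamma_k=\frac{\gamma_0}{\sqrt{k+1}}$, $\gamma_0>0$. Then: (a) If $r=1$, then $\mathbb{E}[\mathrm{G}(\bar x_N(r))]$ converges to zero as $N\to\infty$ at the rate $\mathcal{O}\left(\frac{\ln N}{\sqrt N}\right)$. (b) For any $r<1$, $\mathbb{E}[\mathrm{G}(\bar x_N(r))]$ converges to zero as $N\to\infty$ at the rate $\mathcal{O}\left(\frac{1}{\sqrt N}\right)$.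
   Context: $\|\cdot\|$ is the Euclidean norm, $\Pi_X$ is Euclidean projection onto $X$. $\epsilon\ge0$ is fixed and $X^\epsilon=X+\{z\in\mathbb{R}^n:\|z\|\le\epsilon\}$ (so $X^0=X$; no smoothing is used here). $\xi$ is an $\mathbb{R}^d$-valued random vector, $\Phi:X^\epsilon\times\mathbb{R}^d\to\mathbb{R}^n$. VI$(X,F)$ asks for $x^*\in X$ with $F(x^* )^T(x-x^* )\ge0$ for all $x\in X$. aSA$_r$ algorithm ($r\in\mathbb{R}$): $x_0\in X$ is a random vector with $\mathbb{E}[\|x_0\|^2]<\infty$, and for $k\ge0$, $x_{k+1}=\Pi_X\big(x_k-\gamma_k\Phi(x_k,\xi_k)\big)$, $\ \bar x_{k+1}(r)=\frac{\sum_{t=0}^k\gamma_t^rx_t}{\sum_{t=0}^k\gamma_t^r}$. Gap function: $\mathrm{G}(x)=\sup_{y\in X}F(y)^T(x-y)$ for $x\in X$. *)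

theory Defs
  imports "HOL-Probability.Probability"
begin

definition enlarge :: "(real ^ 'n) set \<Rightarrow> real \<Rightarrow> (real ^ 'n) set" where
  "enlarge X \<epsilon> = {x + z | x z. x \<in> X \<and> norm z \<le> \<epsilon>}"

definition vi_solutions :: "(real ^ 'n) set \<Rightarrow> (real ^ 'n \<Rightarrow> real ^ 'n) \<Rightarrow> (real ^ 'n) set" where
  "vi_solutions X F = {x \<in> X. \<forall>y\<in>X. F x \<bullet> (y - x) \<ge> 0}"

definition monotone_map_on :: "(real ^ 'n) set \<Rightarrow> (real ^ 'n \<Rightarrow> real ^ 'n) \<Rightarrow> bool" where
  "monotone_map_on S F \<longleftrightarrow> (\<forall>x\<in>S. \<forall>y\<in>S. (F x - F y) \<bullet> (x - y) \<ge> 0)"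

(* The supremum is taken in the reals, so it is meaningful only when X is nonempty and
   the values are bounded above, e.g. X compact and F continuous on X. *)
definition gap :: "(real ^ 'n) set \<Rightarrow> (real ^ 'n \<Rightarrow> real ^ 'n) \<Rightarrow> real ^ 'n \<Rightarrow> real" where
  "gap X F x = (SUP y\<in>X. F y \<bullet> (x - y))"

primrec aSA_iterate ::
  "(real ^ 'n) set \<Rightarrow> (real ^ 'n \<Rightarrow> real ^ 'd \<Rightarrow> real ^ 'n) \<Rightarrow> (nat \<Rightarrow> real) \<Rightarrow>
   (nat \<Rightarrow> 'w \<Rightarrow> real ^ 'd) \<Rightarrow> ('w \<Rightarrow> real ^ 'n) \<Rightarrow> nat \<Rightarrow> 'w \<Rightarrow> real ^ 'n" where
  "aSA_iterate X \<Phi> \<gamma> \<xi>s x0 0 = x0"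
| "aSA_iterate X \<Phi> \<gamma> \<xi>s x0 (Suc k) = (\<lambda>\<omega>.
     closest_point X (aSA_iterate X \<Phi> \<gamma> \<xi>s x0 k \<omega>
       - \<gamma> k *\<^sub>R \<Phi> (aSA_iterate X \<Phi> \<gamma> \<xi>s x0 k \<omega>) (\<xi>s k \<omega>)))"

(* The average with index N uses the iterates 0, ..., N - 1; index 0 carries no meaning. *)
definition aSA_average ::
  "(real ^ 'n) set \<Rightarrow> (real ^ 'n \<Rightarrow> real ^ 'd \<Rightarrow> real ^ 'n) \<Rightarrow> (nat \<Rightarrow> real) \<Rightarrow>
   (nat \<Rightarrow> 'w \<Rightarrow> real ^ 'd) \<Rightarrow> ('w \<Rightarrow> real ^ 'n) \<Rightarrow> real \<Rightarrow> nat \<Rightarrow> 'w \<Rightarrow> real ^ 'n" where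
  "aSA_average X \<Phi> \<gamma> \<xi>s x0 r N \<omega> =
     (\<Sum>t<N. (\<gamma> t powr r) *\<^sub>R aSA_iterate X \<Phi> \<gamma> \<xi>s x0 t \<omega>) /\<^sub>R (\<Sum>t<N. \<gamma> t powr r)"

(* indep_var forces both random variables into one type; for variables with values in
   different types, independence is stated for the generated sigma-algebras. *)
definition indep_rvs ::
  "'w measure \<Rightarrow> 'a measure \<Rightarrow> ('w \<Rightarrow> 'a) \<Rightarrow> 'b measure \<Rightarrow> ('w \<Rightarrow> 'b) \<Rightarrow> bool" where
  "indep_rvs M A U B V \<longleftrightarrow> U \<in> measurable M A \<and> V \<in> measurable M B \<and>
     prob_space.indep_set M (sets (vimage_algebra (space M) U A))
                            (sets (vimage_algebra (space M) V B))"

end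

theory Submission
  imports Defs
begin

text \<open>
  Nonexpansiveness of the projection gives, for every fixed \<open>y\<close> in \<open>X\<close>, a telescoping bound for
  \<open>\<gamma>\<^sub>k \<Phi>(x\<^sub>k, \<xi>\<^sub>k) \<bullet> (x\<^sub>k - y)\<close>, and monotonicity replaces \<open>F(x\<^sub>k)\<close> by \<open>F(y)\<close>. The remaining noise term
  depends on \<open>y\<close>, which is random once the supremum in the gap function is taken; an auxiliary
  projected sequence driven by the negated noise absorbs this dependence. Multiplying the steps by
  \<open>\<gamma>\<^sub>k\<close> to the power \<open>r - 1\<close>, nondecreasing in \<open>k\<close> because \<open>r \<le> 1\<close>, and summing by parts bounds the expected
  gap of the \<open>N\<close>-th average by a constant times
  \<open>(\<gamma>\<^bsub>N-1\<^esub> powr (r - 1) + (\<Sum>k<N. \<gamma>\<^sub>k powr (r + 1))) / (\<Sum>k<N. \<gamma>\<^sub>k powr r)\<close>; power sums then give the rates.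
\<close>

section \<open>Independence of variables with values in different types\<close>

context prob_space begin

text \<open>A generated sigma-algebra consists exactly of the preimages of measurable sets, so
  independence becomes a product rule on preimages.\<close>

lemma indep_rvs_iff:
  "indep_rvs M A U B V \<longleftrightarrow> U \<in> measurable M A \<and> V \<in> measurable M B \<and>
     (\<forall>a\<in>sets A. \<forall>b\<in>sets B. prob (U -` a \<inter> space M \<inter> (V -` b \<inter> space M)) =
        prob (U -` a \<inter> space M) * prob (V -` b \<inter> space M))"
proof -
  have U: "sets (vimage_algebra (space M) U A) = (\<lambda>c. U -` c \<inter> space M) ` sets A"
      "(\<lambda>c. U -` c \<inter> space M) ` sets A \<subseteq> events" if "U \<in> measurable M A"
    using that by (auto simp: sets_vimage_algebra2 measurable_space image_def)
  have V: "sets (vimage_algebra (space M) V B) = (\<lambda>c. V -` c \<inter> space M) ` sets B"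
      "(\<lambda>c. V -` c \<inter> space M) ` sets B \<subseteq> events" if "V \<in> measurable M B"
    using that by (auto simp: sets_vimage_algebra2 measurable_space image_def)
  show ?thesis
    unfolding indep_rvs_def indep_sets2_eq
    by (intro conj_cong refl) (simp add: U V)
qed

text \<open>The product rule on preimages is the product formula on rectangles, and rectangles
  determine a product of probability measures.\<close>

lemma indep_rvs_distr:
  assumes "indep_rvs M A U B V"
  shows "distr M A U \<Otimes>\<^sub>M distr M B V = distr M (A \<Otimes>\<^sub>M B) (\<lambda>\<omega>. (U \<omega>, V \<omega>))"
proof -
  have U[measurable]: "U \<in> measurable M A" and V[measurable]: "V \<in> measurable M B"
    using assms by (auto simp: indep_rvs_iff)
  interpret U: prob_space "distr M A U" by (rule prob_space_distr) fact
  interpret V: prob_space "distr M B V" by (rule prob_space_distr) fact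
  show ?thesis
  proof (rule pair_measure_eqI)
    fix a b assume "a \<in> sets (distr M A U)" "b \<in> sets (distr M B V)"
    then have [measurable]: "a \<in> sets A" "b \<in> sets B" by auto
    have "(\<lambda>\<omega>. (U \<omega>, V \<omega>)) -` (a \<times> b) \<inter> space M = U -` a \<inter> space M \<inter> (V -` b \<inter> space M)"
      by auto
    moreover have "prob (U -` a \<inter> space M \<inter> (V -` b \<inter> space M)) =
        prob (U -` a \<inter> space M) * prob (V -` b \<inter> space M)"
      using assms by (auto simp: indep_rvs_iff)
    ultimately show "emeasure (distr M A U) a * emeasure (distr M B V) b =
        emeasure (distr M (A \<Otimes>\<^sub>M B) (\<lambda>\<omega>. (U \<omega>, V \<omega>))) (a \<times> b)"
      by (simp add: emeasure_distr emeasure_eq_measure ennreal_mult')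
  qed (auto intro: U.sigma_finite_measure_axioms V.sigma_finite_measure_axioms
        cong: sets_pair_measure_cong)
qed

text \<open>Preimages under \<open>Z\<close> and \<open>W\<close> lie in the sigma-algebras
  generated by \<open>U\<close> and \<open>V\<close>, where independence is given. A recursively
  defined variable can thus inherit independence without being displayed as a function of
  \<open>U\<close>.\<close>

lemma indep_rvs_factor:
  assumes "indep_rvs M A U B V"
    and Z: "Z \<in> measurable (vimage_algebra (space M) U A) A'"
    and W: "W \<in> measurable (vimage_algebra (space M) V B) B'"
  shows "indep_rvs M A' Z B' W"
proof -
  have UV: "U \<in> measurable M A" "V \<in> measurable M B"
    using assms by (auto simp: indep_rvs_iff)
  have id: "(\<lambda>x. x) \<in> measurable M (vimage_algebra (space M) U A)"
    "(\<lambda>x. x) \<in> measurable M (vimage_algebra (space M) V B)"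
    using UV by (auto intro!: measurable_vimage_algebra2)
  have "Z \<in> measurable M A'" "W \<in> measurable M B'"
    using measurable_compose[OF id(1) Z] measurable_compose[OF id(2) W] by simp_all
  moreover have "prob (Z -` a \<inter> space M \<inter> (W -` b \<inter> space M)) =
      prob (Z -` a \<inter> space M) * prob (W -` b \<inter> space M)"
    if "a \<in> sets A'" "b \<in> sets B'" for a b
    using indep_setD[of "sets (vimage_algebra (space M) U A)" "sets (vimage_algebra (space M) V B)"
        "Z -` a \<inter> space M" "W -` b \<inter> space M"]
      assms(1) measurable_sets[OF Z that(1)] measurable_sets[OF W that(2)]
    by (simp add: indep_rvs_def)
  ultimately show ?thesis by (simp add: indep_rvs_iff)
qed

lemma indep_rvs_compose:
  assumes "indep_rvs M A U B V" "f \<in> measurable A A'" "g \<in> measurable B B'"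
  shows "indep_rvs M A' (\<lambda>\<omega>. f (U \<omega>)) B' (\<lambda>\<omega>. g (V \<omega>))"
proof (rule indep_rvs_factor[OF assms(1)])
  have UV: "U \<in> measurable M A" "V \<in> measurable M B"
    using assms by (auto simp: indep_rvs_iff)
  have U: "U \<in> measurable (vimage_algebra (space M) U A) A"
    using UV by (intro measurable_vimage_algebra1) (auto dest: measurable_space)
  have V: "V \<in> measurable (vimage_algebra (space M) V B) B"
    using UV by (intro measurable_vimage_algebra1) (auto dest: measurable_space)
  show "(\<lambda>\<omega>. f (U \<omega>)) \<in> measurable (vimage_algebra (space M) U A) A'"
    by (rule measurable_compose[OF U assms(2)])
  show "(\<lambda>\<omega>. g (V \<omega>)) \<in> measurable (vimage_algebra (space M) V B) B'"
    by (rule measurable_compose[OF V assms(3)])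
qed

text \<open>The two hypotheses make the joint law of the triple an iterated product. Regrouping it
  has to treat arbitrary sets \<open>d\<close> and not only rectangles, hence the slicing over the
  values of \<open>U\<close>.\<close>

lemma indep_rvs_assoc:
  assumes UVW: "indep_rvs M A U (B \<Otimes>\<^sub>M C) (\<lambda>\<omega>. (V \<omega>, W \<omega>))" and VW: "indep_rvs M B V C W"
  shows "indep_rvs M (A \<Otimes>\<^sub>M B) (\<lambda>\<omega>. (U \<omega>, V \<omega>)) C W"
proof -
  have UV: "indep_rvs M A U B V"
    using indep_rvs_compose[OF UVW measurable_ident measurable_fst] by simp
  have [measurable]: "U \<in> measurable M A" "V \<in> measurable M B" "W \<in> measurable M C"
    using UV VW by (auto simp: indep_rvs_iff)
  interpret U: prob_space "distr M A U" by (rule prob_space_distr) measurable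
  interpret V: prob_space "distr M B V" by (rule prob_space_distr) measurable
  interpret W: prob_space "distr M C W" by (rule prob_space_distr) measurable
  interpret VWp: prob_space "distr M (B \<Otimes>\<^sub>M C) (\<lambda>\<omega>. (V \<omega>, W \<omega>))"
    by (rule prob_space_distr) measurable
  have "emeasure M ((\<lambda>\<omega>. (U \<omega>, V \<omega>)) -` d \<inter> space M \<inter> (W -` c \<inter> space M)) =
      emeasure M ((\<lambda>\<omega>. (U \<omega>, V \<omega>)) -` d \<inter> space M) * emeasure M (W -` c \<inter> space M)"
    if [measurable]: "d \<in> sets (A \<Otimes>\<^sub>M B)" "c \<in> sets C" for d c
  proof -
    \<comment> \<open>\<open>e\<close> is the product of \<open>d\<close> and \<open>c\<close> with
      the coordinates regrouped. Its section at a fixed \<open>u\<close> is a rectangle, so the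
      measure of the section factors.\<close>
    define e where "e = {p \<in> space (A \<Otimes>\<^sub>M (B \<Otimes>\<^sub>M C)). (fst p, fst (snd p)) \<in> d \<and> snd (snd p) \<in> c}"
    have [measurable]: "e \<in> sets (A \<Otimes>\<^sub>M (B \<Otimes>\<^sub>M C))" unfolding e_def by measurable
    have sec: "Pair u -` e = (Pair u -` d) \<times> c" if "u \<in> space A" for u
      using that sets.sets_into_space[OF \<open>d \<in> _\<close>] sets.sets_into_space[OF \<open>c \<in> _\<close>]
      by (auto simp: e_def space_pair_measure)
    have "(\<lambda>\<omega>. (U \<omega>, V \<omega>)) -` d \<inter> space M \<inter> (W -` c \<inter> space M) =
        (\<lambda>\<omega>. (U \<omega>, V \<omega>, W \<omega>)) -` e \<inter> space M"
      using measurable_space[OF \<open>U \<in> _\<close>] measurable_space[OF \<open>V \<in> _\<close>] measurable_space[OF \<open>W \<in> _\<close>]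
      by (auto simp: e_def space_pair_measure)
    also have "emeasure M \<dots> = emeasure (distr M (A \<Otimes>\<^sub>M (B \<Otimes>\<^sub>M C)) (\<lambda>\<omega>. (U \<omega>, V \<omega>, W \<omega>))) e"
      by (simp add: emeasure_distr)
    also have "\<dots> = emeasure (distr M A U \<Otimes>\<^sub>M (distr M B V \<Otimes>\<^sub>M distr M C W)) e"
      by (simp add: indep_rvs_distr[OF UVW] indep_rvs_distr[OF VW])
    also have "\<dots> = (\<integral>\<^sup>+u. emeasure (distr M B V \<Otimes>\<^sub>M distr M C W) (Pair u -` e) \<partial>distr M A U)"
      unfolding indep_rvs_distr[OF VW]
      by (rule VWp.emeasure_pair_measure_alt)
        (simp cong: sets_pair_measure_cong)
    also have "\<dots> = (\<integral>\<^sup>+u. emeasure (distr M B V) (Pair u -` d) * emeasure (distr M C W) c \<partial>distr M A U)"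
    proof (rule nn_integral_cong)
      fix u assume "u \<in> space (distr M A U)"
      then show "emeasure (distr M B V \<Otimes>\<^sub>M distr M C W) (Pair u -` e) =
          emeasure (distr M B V) (Pair u -` d) * emeasure (distr M C W) c"
        using sets_Pair1[OF \<open>d \<in> _\<close>, of u]
        by (simp add: sec W.emeasure_pair_measure_Times del: emeasure_distr)
    qed
    also have "\<dots> = (\<integral>\<^sup>+u. emeasure (distr M B V) (Pair u -` d) \<partial>distr M A U) * emeasure (distr M C W) c"
    proof (rule nn_integral_multc)
      show "(\<lambda>u. emeasure (distr M B V) (Pair u -` d)) \<in> borel_measurable (distr M A U)"
        by (rule V.measurable_emeasure_Pair) (simp cong: sets_pair_measure_cong)
    qed
    also have "(\<integral>\<^sup>+u. emeasure (distr M B V) (Pair u -` d) \<partial>distr M A U) =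
        emeasure (distr M A U \<Otimes>\<^sub>M distr M B V) d"
      by (rule V.emeasure_pair_measure_alt[symmetric]) (simp cong: sets_pair_measure_cong)
    also have "\<dots> = emeasure M ((\<lambda>\<omega>. (U \<omega>, V \<omega>)) -` d \<inter> space M)"
      by (simp add: indep_rvs_distr[OF UV] emeasure_distr)
    finally show ?thesis by (simp add: emeasure_distr)
  qed
  then show ?thesis
    by (simp add: indep_rvs_iff emeasure_eq_measure flip: ennreal_mult')
qed

lemma indep_rvs_of_indep_var:
  assumes "indep_var A U B V"
  shows "indep_rvs M A U B V"
proof -
  have "(\<lambda>\<omega>. (U \<omega>, V \<omega>)) -` (a \<times> b) \<inter> space M = U -` a \<inter> space M \<inter> (V -` b \<inter> space M)" for a b
    by auto
  then show ?thesis
    using indep_varD[OF assms] indep_var_rv1[OF assms] indep_var_rv2[OF assms]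
    by (simp add: indep_rvs_iff)
qed

text \<open>Fubini for the product law. Freezing \<open>U\<close> and averaging over
  \<open>V\<close> alone stands in for conditional expectation given \<open>U\<close>. The
  nonnegative version presupposes no integrability and can therefore be used to establish
  it.\<close>

lemma nn_integral_indep_rvs:
  assumes UV: "indep_rvs M A U B V" and f: "f \<in> borel_measurable (A \<Otimes>\<^sub>M B)"
  shows "(\<integral>\<^sup>+\<omega>. f (U \<omega>, V \<omega>) \<partial>M) = (\<integral>\<^sup>+\<omega>. \<integral>\<^sup>+\<omega>'. f (U \<omega>, V \<omega>') \<partial>M \<partial>M)"
proof -
  have [measurable]: "U \<in> measurable M A" "V \<in> measurable M B"
    using UV by (auto simp: indep_rvs_iff)
  note f[measurable]
  interpret V: prob_space "distr M B V" by (rule prob_space_distr) measurable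
  have "(\<integral>\<^sup>+\<omega>. f (U \<omega>, V \<omega>) \<partial>M) = (\<integral>\<^sup>+p. f p \<partial>(distr M A U \<Otimes>\<^sub>M distr M B V))"
    by (simp add: indep_rvs_distr[OF UV] nn_integral_distr)
  also have "\<dots> = (\<integral>\<^sup>+u. \<integral>\<^sup>+v. f (u, v) \<partial>distr M B V \<partial>distr M A U)"
    by (rule V.nn_integral_fst[symmetric]) (simp cong: measurable_cong_sets sets_pair_measure_cong)
  also have "\<dots> = (\<integral>\<^sup>+u. \<integral>\<^sup>+\<omega>'. f (u, V \<omega>') \<partial>M \<partial>distr M A U)"
  proof (rule nn_integral_cong)
    fix u assume "u \<in> space (distr M A U)"
    then have "(\<lambda>v. f (u, v)) \<in> borel_measurable B"
      by (intro measurable_compose[OF measurable_Pair1' f]) simp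
    then show "(\<integral>\<^sup>+v. f (u, v) \<partial>distr M B V) = (\<integral>\<^sup>+\<omega>'. f (u, V \<omega>') \<partial>M)"
      by (simp add: nn_integral_distr)
  qed
  also have "\<dots> = (\<integral>\<^sup>+\<omega>. \<integral>\<^sup>+\<omega>'. f (U \<omega>, V \<omega>') \<partial>M \<partial>M)"
    by (rule nn_integral_distr) measurable
  finally show ?thesis .
qed

lemma integral_indep_rvs:
  fixes f :: "_ \<Rightarrow> _::{banach, second_countable_topology}"
  assumes UV: "indep_rvs M A U B V" and f: "f \<in> borel_measurable (A \<Otimes>\<^sub>M B)"
    and int: "integrable M (\<lambda>\<omega>. f (U \<omega>, V \<omega>))"
  shows "(\<integral>\<omega>. f (U \<omega>, V \<omega>) \<partial>M) = (\<integral>\<omega>. \<integral>\<omega>'. f (U \<omega>, V \<omega>') \<partial>M \<partial>M)"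
proof -
  have [measurable]: "U \<in> measurable M A" "V \<in> measurable M B"
    using UV by (auto simp: indep_rvs_iff)
  note f[measurable]
  interpret U: prob_space "distr M A U" by (rule prob_space_distr) measurable
  interpret V: prob_space "distr M B V" by (rule prob_space_distr) measurable
  interpret UV: pair_prob_space "distr M A U" "distr M B V" ..
  have "(\<integral>\<omega>. f (U \<omega>, V \<omega>) \<partial>M) = (\<integral>p. f p \<partial>(distr M A U \<Otimes>\<^sub>M distr M B V))"
    by (simp add: indep_rvs_distr[OF UV] integral_distr)
  also have "\<dots> = (\<integral>u. \<integral>v. f (u, v) \<partial>distr M B V \<partial>distr M A U)"
    by (rule UV.integral_fst'[symmetric]) (simp add: indep_rvs_distr[OF UV] integrable_distr_eq int)
  also have "\<dots> = (\<integral>u. \<integral>\<omega>'. f (u, V \<omega>') \<partial>M \<partial>distr M A U)"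
  proof (intro Bochner_Integration.integral_cong refl integral_distr)
    fix u assume "u \<in> space (distr M A U)"
    then show "(\<lambda>v. f (u, v)) \<in> borel_measurable B"
      by (intro measurable_compose[OF measurable_Pair1' f]) simp
  qed measurable
  also have "\<dots> = (\<integral>\<omega>. \<integral>\<omega>'. f (U \<omega>, V \<omega>') \<partial>M \<partial>M)"
    by (rule integral_distr) measurable
  finally show ?thesis .
qed

end

section \<open>Power sums and summation by parts\<close>

lemma powr_increment:
  fixes x q :: real
  assumes "0 \<le> x" "0 < q"
  obtains z where "x < z" "z < x + 1" "(x + 1) powr q - x powr q = q * z powr (q - 1)"
proof -
  have "\<exists>l z. x < z \<and> z < x + 1 \<and> DERIV (\<lambda>t. t powr q) z :> l \<and>
      (x + 1) powr q - x powr q = (x + 1 - x) * l"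
  proof (rule MVT)
    show "continuous_on {x..x + 1} (\<lambda>t. t powr q)"
      using assms by (intro continuous_on_powr' continuous_on_id continuous_on_const) auto
    show "(\<lambda>t. t powr q) differentiable (at t)" if "x < t" "t < x + 1" for t
      using that assms has_real_derivative_powr[of t q] real_differentiable_def by auto
  qed simp
  then obtain l z where z: "x < z" "z < x + 1" "DERIV (\<lambda>t. t powr q) z :> l"
      "(x + 1) powr q - x powr q = l" by auto
  moreover have "l = q * z powr (q - 1)"
    using DERIV_unique[OF z(3) has_real_derivative_powr] z(1) assms(1) by simp
  ultimately show thesis using that by simp
qed

lemma sum_powr_increment:
  assumes "0 < (q::real)"
  shows "(\<Sum>k<n. (real k + 1) powr q - real k powr q) = real n powr q"
  using sum_lessThan_telescope[of "\<lambda>k. real k powr q" n] assms by (simp add: add.commute)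

text \<open>For \<open>q \<le> 1\<close> the mean value theorem bounds each term by
  \<open>1 / q\<close> times an increment of \<open>t powr q\<close>, and the increments telescope.
  For larger \<open>q\<close> every term is at most \<open>n powr (q - 1)\<close>. The
  \<open>max\<close> is one constant for both cases.\<close>

lemma sum_powr_le:
  assumes q: "0 < (q::real)"
  shows "(\<Sum>k<n. (real k + 1) powr (q - 1)) \<le> max 1 (1 / q) * real n powr q"
proof (cases "q \<le> 1")
  case True
  have "(real k + 1) powr (q - 1) \<le> 1 / q * ((real k + 1) powr q - real k powr q)" for k
  proof -
    obtain z where z: "real k < z" "z < real k + 1"
        "(real k + 1) powr q - real k powr q = q * z powr (q - 1)"
      using powr_increment[of "real k" q] q by auto
    then show ?thesis using powr_mono2'[of "q - 1" z "real k + 1"] q True by simp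
  qed
  then have "(\<Sum>k<n. (real k + 1) powr (q - 1)) \<le> (\<Sum>k<n. 1 / q * ((real k + 1) powr q - real k powr q))"
    by (rule sum_mono)
  also have "\<dots> = 1 / q * real n powr q"
    by (simp only: sum_distrib_left[symmetric] sum_powr_increment[OF q])
  also have "\<dots> \<le> max 1 (1 / q) * real n powr q" by (intro mult_right_mono) auto
  finally show ?thesis .
next
  case False
  have "(\<Sum>k<n. (real k + 1) powr (q - 1)) \<le> (\<Sum>k<n. real n powr (q - 1))"
    using False by (intro sum_mono powr_mono2) auto
  also have "\<dots> = real n powr q" by (cases "n = 0") (auto simp: powr_diff)
  also have "\<dots> \<le> max 1 (1 / q) * real n powr q" using False by simp
  finally show ?thesis .
qed

text \<open>The comparisons of \<open>sum_powr_le\<close> with the cases exchanged: for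
  \<open>q \<le> 1\<close> every term is at least \<open>n powr (q - 1)\<close>, and for larger
  \<open>q\<close> the terms dominate the scaled increments.\<close>

lemma sum_powr_ge:
  assumes q: "0 < (q::real)"
  shows "min 1 (1 / q) * real n powr q \<le> (\<Sum>k<n. (real k + 1) powr (q - 1))"
proof (cases "q \<le> 1")
  case True
  have "min 1 (1 / q) * real n powr q \<le> real n powr q"
    using mult_right_mono[of "min 1 (1 / q)" 1 "real n powr q"] by simp
  also have "\<dots> = (\<Sum>k<n. real n powr (q - 1))" by (cases "n = 0") (auto simp: powr_diff)
  also have "\<dots> \<le> (\<Sum>k<n. (real k + 1) powr (q - 1))"
    using True by (intro sum_mono powr_mono2') auto
  finally show ?thesis .
next
  case False
  have "1 / q * ((real k + 1) powr q - real k powr q) \<le> (real k + 1) powr (q - 1)" for k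
  proof -
    obtain z where z: "real k < z" "z < real k + 1"
        "(real k + 1) powr q - real k powr q = q * z powr (q - 1)"
      using powr_increment[of "real k" q] q by auto
    then show ?thesis using powr_mono2[of "q - 1" z "real k + 1"] q False by simp
  qed
  then have "(\<Sum>k<n. 1 / q * ((real k + 1) powr q - real k powr q)) \<le> (\<Sum>k<n. (real k + 1) powr (q - 1))"
    by (rule sum_mono)
  then have "1 / q * real n powr q \<le> (\<Sum>k<n. (real k + 1) powr (q - 1))"
    by (simp only: sum_distrib_left[symmetric] sum_powr_increment[OF q])
  moreover have "min 1 (1 / q) * real n powr q \<le> 1 / q * real n powr q"
    by (intro mult_right_mono) auto
  ultimately show ?thesis by linarith
qed

text \<open>The difference \<open>harm n - ln n\<close> decreases from its value 1 at
  \<open>n = 1\<close>.\<close>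

lemma sum_inverse_le_ln:
  assumes "0 < n"
  shows "(\<Sum>k<n. 1 / (real k + 1)) \<le> 1 + ln (real n)"
proof -
  obtain m where m: "n = Suc m" using assms gr0_implies_Suc by blast
  have "(harm (Suc m) :: real) - ln (Suc m) \<le> harm (Suc 0) - ln (Suc 0)"
    using decseqD[OF decseq_harm_diff_ln, of 0 m] by simp
  then have "(harm n :: real) \<le> 1 + ln n" by (simp add: m harm_expand)
  moreover have "(\<Sum>k<n. 1 / (real k + 1)) = harm n"
    unfolding harm_def
    by (rule sum.reindex_bij_witness[of _ "\<lambda>k. k - 1" Suc]) (auto simp: divide_simps)
  ultimately show ?thesis by simp
qed

text \<open>Abel summation: the increments of \<open>c\<close> are nonnegative and multiply values
  of \<open>a\<close> that are at most \<open>A\<close>, so they add up to the last weight.\<close>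

lemma sum_mult_diff_le:
  fixes c a :: "nat \<Rightarrow> real"
  assumes c: "mono c" "0 \<le> c 0" and a: "\<And>k. 0 \<le> a k" "\<And>k. a k \<le> A"
  shows "(\<Sum>k<Suc n. c k * (a k - a (Suc k))) \<le> A * c n"
proof -
  \<comment> \<open>The induction needs the subtracted boundary term; it is dropped only at the end,
    by nonnegativity.\<close>
  have "(\<Sum>k<Suc n. c k * (a k - a (Suc k))) \<le> A * c n - c n * a (Suc n)"
  proof (induction n)
    case 0
    then show ?case using c a(2)[of 0] mult_right_mono[of "a 0" A "c 0"] by (simp add: algebra_simps)
  next
    case (Suc n)
    have "(c (Suc n) - c n) * a (Suc n) \<le> (c (Suc n) - c n) * A"
      using monoD[OF c(1), of n "Suc n"] a(2) by (intro mult_left_mono) auto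
    with Suc show ?case by (simp add: algebra_simps)
  qed
  moreover have "0 \<le> c n" using c monoD[OF c(1), of 0 n] by simp
  ultimately show ?thesis using a(1)[of "Suc n"] mult_nonneg_nonneg[of "c n" "a (Suc n)"] by linarith
qed

section \<open>Projection steps and regularity of the gap function\<close>

lemma closest_point_step:
  fixes X :: "(real ^ 'n) set"
  assumes X: "closed X" "convex X" and y: "y \<in> X"
  shows "(norm (closest_point X (x - s *\<^sub>R g) - y))\<^sup>2 \<le>
    (norm (x - y))\<^sup>2 - 2 * s * (g \<bullet> (x - y)) + s\<^sup>2 * (norm g)\<^sup>2"
proof -
  \<comment> \<open>A point \<open>y\<close> of \<open>X\<close> is its own projection, so
    nonexpansiveness applies to the distance from \<open>y\<close>.\<close>
  have "norm (closest_point X (x - s *\<^sub>R g) - y) \<le> norm (x - s *\<^sub>R g - y)"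
    using closest_point_lipschitz[of X "x - s *\<^sub>R g" y] X y by (auto simp: closest_point_self dist_norm)
  then have "(norm (closest_point X (x - s *\<^sub>R g) - y))\<^sup>2 \<le> (norm (x - s *\<^sub>R g - y))\<^sup>2"
    by (simp add: power_mono)
  also have "\<dots> = (norm (x - y))\<^sup>2 - 2 * s * (g \<bullet> (x - y)) + s\<^sup>2 * (norm g)\<^sup>2"
    by (simp add: power2_norm_eq_inner inner_diff_left inner_diff_right inner_commute algebra_simps)
      (simp add: power2_eq_square)
  finally show ?thesis .
qed

lemma gap_le:
  assumes "X \<noteq> {}" and "\<And>y. y \<in> X \<Longrightarrow> F y \<bullet> (x - y) \<le> c"
  shows "gap X F x \<le> c"
  unfolding gap_def by (rule cSUP_least) (use assms in auto)

context
  fixes X :: "(real ^ 'n) set" and F :: "real ^ 'n \<Rightarrow> real ^ 'n" and B :: real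
  assumes X: "bounded X" and B: "\<And>y. y \<in> X \<Longrightarrow> norm (F y) \<le> B"
begin

text \<open>Makes the real supremum genuine at every \<open>x\<close>, also outside
  \<open>X\<close>, so that continuity can be shown on the whole space.\<close>

lemma bdd_above_gap: "bdd_above ((\<lambda>y. F y \<bullet> (x - y)) ` X)"
proof -
  obtain R where R: "\<And>y. y \<in> X \<Longrightarrow> norm y \<le> R" using X by (auto simp: bounded_iff)
  show ?thesis
  proof (rule bdd_aboveI2)
    fix y assume y: "y \<in> X"
    have "F y \<bullet> (x - y) \<le> norm (F y) * norm (x - y)" by (rule norm_cauchy_schwarz)
    also have "\<dots> \<le> B * (norm x + R)"
      using B[OF y] norm_triangle_ineq4[of x y] R[OF y] norm_ge_zero[of "F y"]
      by (intro mult_mono) (linarith | simp)+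
    finally show "F y \<bullet> (x - y) \<le> B * (norm x + R)" .
  qed
qed

lemma gap_nonneg:
  assumes "x \<in> X"
  shows "0 \<le> gap X F x"
  unfolding gap_def using cSUP_upper[OF assms bdd_above_gap, of x] by simp

text \<open>Each function under the supremum is affine with slope \<open>F y\<close>, whose norm is
  at most \<open>B\<close>; the supremum inherits this Lipschitz bound.\<close>

lemma gap_diff_le: "X \<noteq> {} \<Longrightarrow> gap X F x \<le> gap X F x' + B * norm (x - x')"
proof (rule gap_le)
  fix y assume y: "y \<in> X"
  have "F y \<bullet> (x - y) = F y \<bullet> (x' - y) + F y \<bullet> (x - x')" by (simp add: inner_diff_right)
  also have "F y \<bullet> (x' - y) \<le> gap X F x'"
    unfolding gap_def by (rule cSUP_upper[OF y bdd_above_gap])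
  also have "F y \<bullet> (x - x') \<le> B * norm (x - x')"
    using norm_cauchy_schwarz[of "F y" "x - x'"] mult_right_mono[OF B[OF y], of "norm (x - x')"] by simp
  finally show "F y \<bullet> (x - y) \<le> gap X F x' + B * norm (x - x')" by simp
qed

text \<open>Gives measurability of the gap at the random average.\<close>

lemma continuous_on_gap: "X \<noteq> {} \<Longrightarrow> continuous_on UNIV (gap X F)"
proof (rule lipschitz_on_continuous_on)
  assume ne: "X \<noteq> {}"
  then have "0 \<le> B" using B norm_ge_zero order_trans by blast
  moreover have "\<bar>gap X F x - gap X F x'\<bar> \<le> B * norm (x - x')" for x x'
    using gap_diff_le[OF ne, of x x'] gap_diff_le[OF ne, of x' x]
    by (simp add: abs_le_iff norm_minus_commute)
  ultimately show "B-lipschitz_on UNIV (gap X F)"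
    by (intro lipschitz_onI) (auto simp: dist_norm)
qed

end

section \<open>The projected scheme for general positive nonincreasing steps\<close>

locale stochastic_approximation = prob_space M
  for M :: "'w measure" +
  fixes X :: "(real ^ 'n) set" and C :: real
    and \<Phi> :: "real ^ 'n \<Rightarrow> real ^ 'd \<Rightarrow> real ^ 'n" and F :: "real ^ 'n \<Rightarrow> real ^ 'n"
    and \<xi> :: "'w \<Rightarrow> real ^ 'd" and \<xi>s :: "nat \<Rightarrow> 'w \<Rightarrow> real ^ 'd"
    and x0 :: "'w \<Rightarrow> real ^ 'n" and \<gamma> :: "nat \<Rightarrow> real"
  assumes X: "closed X" "bounded X" "convex X" "X \<noteq> {}"
    and \<xi>: "\<xi> \<in> borel_measurable M"
    and \<Phi>: "(\<lambda>(x, z). \<Phi> x z) \<in> borel_measurable (restrict_space borel X \<Otimes>\<^sub>M borel)"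
    and F: "\<And>x. x \<in> X \<Longrightarrow> F x = (\<integral>\<omega>. \<Phi> x (\<xi> \<omega>) \<partial>M)"
    and mono: "monotone_map_on X F"
    and cont: "continuous_on X F"
    and square_int: "\<And>x. x \<in> X \<Longrightarrow> integrable M (\<lambda>\<omega>. (norm (\<Phi> x (\<xi> \<omega>)))\<^sup>2)"
    and square_le: "\<And>x. x \<in> X \<Longrightarrow> (\<integral>\<omega>. (norm (\<Phi> x (\<xi> \<omega>)))\<^sup>2 \<partial>M) \<le> C\<^sup>2"
    and x0: "x0 \<in> borel_measurable M" "\<And>\<omega>. \<omega> \<in> space M \<Longrightarrow> x0 \<omega> \<in> X"
    and indep: "indep_vars (\<lambda>_. borel) \<xi>s UNIV"
    and ident: "\<And>k. distr M borel (\<xi>s k) = distr M borel \<xi>"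
    and indep_x0: "indep_rvs M borel x0 (\<Pi>\<^sub>M k\<in>UNIV. borel) (\<lambda>\<omega> k. \<xi>s k \<omega>)"
    and \<gamma>: "\<And>k. 0 < \<gamma> k" "antimono \<gamma>"
begin

abbreviation x :: "nat \<Rightarrow> 'w \<Rightarrow> real ^ 'n" where
  "x \<equiv> aSA_iterate X \<Phi> \<gamma> \<xi>s x0"

abbreviation sample :: "nat \<Rightarrow> 'w \<Rightarrow> real ^ 'n" where
  "sample k \<omega> \<equiv> \<Phi> (x k \<omega>) (\<xi>s k \<omega>)"

abbreviation noise :: "nat \<Rightarrow> 'w \<Rightarrow> real ^ 'n" where
  "noise k \<omega> \<equiv> sample k \<omega> - F (x k \<omega>)"

text \<open>
  The shadow sequence projects the same noise with the opposite sign and does not know the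
  comparison point \<open>y\<close>. Its step inequality bounds \<open>noise k \<bullet> (y - shadow k)\<close>, so that only
  \<open>noise k \<bullet> (x k - shadow k)\<close> remains, which is free of \<open>y\<close> and has mean zero. Hence the supremum
  over \<open>y\<close> can be taken before the expectation.
\<close>

primrec shadow :: "nat \<Rightarrow> 'w \<Rightarrow> real ^ 'n" where
  "shadow 0 = x0"
| "shadow (Suc k) = (\<lambda>\<omega>. closest_point X (shadow k \<omega> - \<gamma> k *\<^sub>R - noise k \<omega>))"

lemma iterates_in: "\<omega> \<in> space M \<Longrightarrow> x k \<omega> \<in> X \<and> shadow k \<omega> \<in> X"
  using X x0 by (cases k) (auto intro: closest_point_in_set)

lemma \<Phi>_measurable[measurable (raw)]:
  assumes "f \<in> measurable N (restrict_space borel X)" "g \<in> borel_measurable N"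
  shows "(\<lambda>\<omega>. \<Phi> (f \<omega>) (g \<omega>)) \<in> borel_measurable N"
  using measurable_compose[OF measurable_Pair[OF assms] \<Phi>] by simp

text \<open>\<open>N\<close> is kept general so that it can be \<open>M\<close> itself or the
  sigma-algebra generated by \<open>x0\<close> and the samples before \<open>k\<close>. The second
  choice expresses that the iterates at time \<open>k\<close> have not seen
  \<open>\<xi>s k\<close>.\<close>

lemma iterates_measurable:
  assumes N: "space N = space M" "x0 \<in> borel_measurable N"
    and "\<And>i. i < k \<Longrightarrow> \<xi>s i \<in> borel_measurable N"
  shows "x k \<in> measurable N (restrict_space borel X) \<and> shadow k \<in> measurable N (restrict_space borel X)"
  using assms(3)
proof (induction k)
  case 0
  then show ?case using N x0 by (auto intro!: measurable_restrict_space2)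
next
  case (Suc k)
  then have xs: "x k \<in> measurable N (restrict_space borel X)" "shadow k \<in> measurable N (restrict_space borel X)"
    and \<xi>k: "\<xi>s k \<in> borel_measurable N" by auto
  have [measurable]: "x k \<in> borel_measurable N" "shadow k \<in> borel_measurable N"
    using xs by (simp_all add: measurable_restrict_space2_iff)
  have [measurable]: "sample k \<in> borel_measurable N"
    using xs(1) \<xi>k by (rule \<Phi>_measurable)
  have [measurable]: "(\<lambda>\<omega>. F (x k \<omega>)) \<in> borel_measurable N"
    by (rule measurable_compose[OF xs(1) borel_measurable_continuous_on_restrict[OF cont]])
  have [measurable]: "closest_point X \<in> borel_measurable borel"
    using X by (intro borel_measurable_continuous_onI continuous_on_closest_point)
  have "x (Suc k) \<in> borel_measurable N" "shadow (Suc k) \<in> borel_measurable N" by simp_all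
  moreover have "x (Suc k) \<in> space N \<rightarrow> X" "shadow (Suc k) \<in> space N \<rightarrow> X"
    using iterates_in[of _ "Suc k"] N by auto
  ultimately show ?case by (blast intro: measurable_restrict_space2)
qed

lemma \<xi>s_measurable[measurable]: "\<xi>s k \<in> borel_measurable M"
  using indep by (auto simp: indep_vars_def)

lemma x_measurable[measurable]: "x k \<in> measurable M (restrict_space borel X)"
  and shadow_measurable[measurable]: "shadow k \<in> measurable M (restrict_space borel X)"
  using iterates_measurable[of M k] x0(1) by auto

lemma x_borel[measurable]: "x k \<in> borel_measurable M"
  and shadow_borel[measurable]: "shadow k \<in> borel_measurable M"
  using x_measurable shadow_measurable by (simp_all add: measurable_restrict_space2_iff)

lemma sample_borel[measurable]: "sample k \<in> borel_measurable M"
  by measurable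

lemma F_borel[measurable]: "F \<in> borel_measurable (restrict_space borel X)"
  by (rule borel_measurable_continuous_on_restrict[OF cont])

text \<open>Both points are determined by \<open>x0\<close> and the earlier samples, which are
  jointly independent of \<open>\<xi>s k\<close>. The pair is needed because the noise is later
  tested against \<open>x k \<omega> - shadow k \<omega>\<close>.\<close>

lemma iterates_indep:
  "indep_rvs M (restrict_space borel X \<Otimes>\<^sub>M restrict_space borel X) (\<lambda>\<omega>. (x k \<omega>, shadow k \<omega>)) borel (\<xi>s k)"
proof -
  let ?P = "\<Pi>\<^sub>M i\<in>{..<k}. borel"
  let ?past = "\<lambda>\<omega>. \<lambda>i\<in>{..<k}. \<xi>s i \<omega>"
  have "indep_rvs M ?P ?past (\<Pi>\<^sub>M i\<in>{k}. borel) (\<lambda>\<omega>. \<lambda>i\<in>{k}. \<xi>s i \<omega>)"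
    by (intro indep_rvs_of_indep_var indep_var_restrict[OF indep]) auto
  \<comment> \<open>Evaluation at \<open>k\<close> turns the block over the singleton index set into
    the sample itself.\<close>
  from indep_rvs_compose[OF this measurable_ident, of "\<lambda>f. f k" borel]
  have past: "indep_rvs M ?P ?past borel (\<xi>s k)" by simp
  \<comment> \<open>Splitting the whole sample sequence into its past and its \<open>k\<close>-th
    entry puts \<open>indep_x0\<close> into the form that \<open>indep_rvs_assoc\<close>
    expects.\<close>
  have "(\<lambda>f. (\<lambda>i\<in>{..<k}. f i, f k)) \<in> measurable (\<Pi>\<^sub>M k\<in>UNIV. borel :: (real ^ 'd) measure) (?P \<Otimes>\<^sub>M borel)"
    by measurable
  from indep_rvs_compose[OF indep_x0 measurable_ident this]
  have "indep_rvs M borel x0 (?P \<Otimes>\<^sub>M borel) (\<lambda>\<omega>. (?past \<omega>, \<xi>s k \<omega>))" by simp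
  from indep_rvs_assoc[OF this past]
  have \<xi>k: "indep_rvs M (borel \<Otimes>\<^sub>M ?P) (\<lambda>\<omega>. (x0 \<omega>, ?past \<omega>)) borel (\<xi>s k)" .
  \<comment> \<open>\<open>G\<close> carries the information available before the
    \<open>k\<close>-th sample is drawn.\<close>
  define G where "G = vimage_algebra (space M) (\<lambda>\<omega>. (x0 \<omega>, ?past \<omega>)) (borel \<Otimes>\<^sub>M ?P)"
  have V: "(\<lambda>\<omega>. (x0 \<omega>, ?past \<omega>)) \<in> measurable G (borel \<Otimes>\<^sub>M ?P)"
    unfolding G_def by (rule measurable_vimage_algebra1) (auto simp: space_pair_measure space_PiM)
  have "x0 \<in> borel_measurable G"
    using measurable_compose[OF V measurable_fst] by simp
  moreover have "\<xi>s i \<in> borel_measurable G" if "i < k" for i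
    using measurable_compose[OF measurable_compose[OF V measurable_snd] measurable_component_singleton[of i]] that
    by simp
  ultimately have "x k \<in> measurable G (restrict_space borel X) \<and> shadow k \<in> measurable G (restrict_space borel X)"
    by (intro iterates_measurable) (auto simp: G_def)
  then have "(\<lambda>\<omega>. (x k \<omega>, shadow k \<omega>)) \<in> measurable G (restrict_space borel X \<Otimes>\<^sub>M restrict_space borel X)"
    by (simp add: measurable_Pair)
  moreover have "\<xi>s k \<in> borel_measurable (vimage_algebra (space M) (\<xi>s k) borel)"
    by (rule measurable_vimage_algebra1) auto
  ultimately show ?thesis
    unfolding G_def by (rule indep_rvs_factor[OF \<xi>k])
qed

section \<open>Moments of samples and noise\<close>

lemma \<Phi>_borel[measurable]: "y \<in> X \<Longrightarrow> \<Phi> y \<in> borel_measurable borel"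
  using measurable_compose[OF measurable_Pair1' \<Phi>, of y] by (simp add: space_restrict_space)

lemma \<Phi>_integrable: "y \<in> X \<Longrightarrow> integrable M (\<lambda>\<omega>. \<Phi> y (\<xi> \<omega>))"
proof (rule Bochner_Integration.integrable_bound)
  assume y: "y \<in> X"
  show "integrable M (\<lambda>\<omega>. 1 + (norm (\<Phi> y (\<xi> \<omega>)))\<^sup>2)"
    using square_int[OF y] by simp
  show "(\<lambda>\<omega>. \<Phi> y (\<xi> \<omega>)) \<in> borel_measurable M"
    using measurable_compose[OF \<xi> \<Phi>_borel[OF y]] .
  have "t \<le> 1 + t\<^sup>2" for t :: real
    using zero_le_power2[of "t - 1/2"] by (simp add: power2_eq_square algebra_simps)
  then show "AE \<omega> in M. norm (\<Phi> y (\<xi> \<omega>)) \<le> norm (1 + (norm (\<Phi> y (\<xi> \<omega>)))\<^sup>2)"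
    by auto
qed

lemma integral_\<xi>s:
  fixes f :: "real ^ 'd \<Rightarrow> 'b::{banach, second_countable_topology}"
  shows "f \<in> borel_measurable borel \<Longrightarrow> (\<integral>\<omega>. f (\<xi>s k \<omega>) \<partial>M) = (\<integral>\<omega>. f (\<xi> \<omega>) \<partial>M)"
  using integral_distr[OF \<xi>s_measurable, of f] integral_distr[OF \<xi>, of f] ident by simp

lemma nn_integral_\<xi>s:
  "f \<in> borel_measurable borel \<Longrightarrow> (\<integral>\<^sup>+\<omega>. f (\<xi>s k \<omega>) \<partial>M) = (\<integral>\<^sup>+\<omega>. f (\<xi> \<omega>) \<partial>M)"
  using nn_integral_distr[OF \<xi>s_measurable, of f] nn_integral_distr[OF \<xi>, of f] ident by simp

text \<open>Independence allows \<open>x k\<close> to be frozen while the fresh sample is averaged;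
  that sample has the law of \<open>\<xi>\<close>, so the second moment bound at fixed points
  applies. Nonnegative integrals come first because integrability is part of the claim.\<close>

lemma sample_square: "integrable M (\<lambda>\<omega>. (norm (sample k \<omega>))\<^sup>2)"
  "(\<integral>\<omega>. (norm (sample k \<omega>))\<^sup>2 \<partial>M) \<le> C\<^sup>2"
proof -
  have m: "(\<lambda>((y, _), z). ennreal ((norm (\<Phi> y z))\<^sup>2)) \<in>
      borel_measurable ((restrict_space borel X \<Otimes>\<^sub>M restrict_space borel X) \<Otimes>\<^sub>M borel)"
    unfolding case_prod_beta by measurable
  have "(\<integral>\<^sup>+\<omega>. ennreal ((norm (sample k \<omega>))\<^sup>2) \<partial>M) =
      (\<integral>\<^sup>+\<omega>. \<integral>\<^sup>+\<omega>'. ennreal ((norm (\<Phi> (x k \<omega>) (\<xi>s k \<omega>')))\<^sup>2) \<partial>M \<partial>M)"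
    using nn_integral_indep_rvs[OF iterates_indep m] by simp
  also have "\<dots> \<le> (\<integral>\<^sup>+\<omega>. ennreal (C\<^sup>2) \<partial>M)"
  proof (rule nn_integral_mono)
    fix \<omega> assume "\<omega> \<in> space M"
    then have y: "x k \<omega> \<in> X" using iterates_in by blast
    have "(\<lambda>z. ennreal ((norm (\<Phi> (x k \<omega>) z))\<^sup>2)) \<in> borel_measurable borel"
      using \<Phi>_borel[OF y] by simp
    from nn_integral_\<xi>s[OF this]
    have "(\<integral>\<^sup>+\<omega>'. ennreal ((norm (\<Phi> (x k \<omega>) (\<xi>s k \<omega>')))\<^sup>2) \<partial>M) =
        ennreal (\<integral>\<omega>'. (norm (\<Phi> (x k \<omega>) (\<xi> \<omega>')))\<^sup>2 \<partial>M)"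
      using nn_integral_eq_integral[OF square_int[OF y]] by simp
    then show "(\<integral>\<^sup>+\<omega>'. ennreal ((norm (\<Phi> (x k \<omega>) (\<xi>s k \<omega>')))\<^sup>2) \<partial>M) \<le> ennreal (C\<^sup>2)"
      using square_le[OF y] by (simp add: ennreal_leI)
  qed
  also have "\<dots> = ennreal (C\<^sup>2)" by (simp add: emeasure_space_1)
  finally have le: "(\<integral>\<^sup>+\<omega>. ennreal ((norm (sample k \<omega>))\<^sup>2) \<partial>M) \<le> ennreal (C\<^sup>2)" .
  show int: "integrable M (\<lambda>\<omega>. (norm (sample k \<omega>))\<^sup>2)"
    using le_less_trans[OF le ennreal_less_top] by (intro integrableI_bounded) simp_all
  show "(\<integral>\<omega>. (norm (sample k \<omega>))\<^sup>2 \<partial>M) \<le> C\<^sup>2"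
    using le nn_integral_eq_integral[OF int] by simp
qed

lemma noise_square:
  assumes B: "\<And>y. y \<in> X \<Longrightarrow> norm (F y) \<le> B"
  shows "integrable M (\<lambda>\<omega>. (norm (noise k \<omega>))\<^sup>2)"
    "(\<integral>\<omega>. (norm (noise k \<omega>))\<^sup>2 \<partial>M) \<le> 2 * C\<^sup>2 + 2 * B\<^sup>2"
proof -
  have le: "(norm (noise k \<omega>))\<^sup>2 \<le> 2 * (norm (sample k \<omega>))\<^sup>2 + 2 * B\<^sup>2"
    if "\<omega> \<in> space M" for \<omega>
  proof -
    have "(norm (noise k \<omega>))\<^sup>2 \<le> (norm (sample k \<omega>) + norm (F (x k \<omega>)))\<^sup>2"
      by (intro power_mono norm_triangle_ineq4) simp
    also have "\<dots> \<le> 2 * (norm (sample k \<omega>))\<^sup>2 + 2 * (norm (F (x k \<omega>)))\<^sup>2"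
      using zero_le_power2[of "norm (sample k \<omega>) - norm (F (x k \<omega>))"]
      by (simp add: power2_eq_square algebra_simps)
    also have "(norm (F (x k \<omega>)))\<^sup>2 \<le> B\<^sup>2"
      using B iterates_in[OF that] by (intro power_mono) auto
    finally show ?thesis by simp
  qed
  have bound: "integrable M (\<lambda>\<omega>. 2 * (norm (sample k \<omega>))\<^sup>2 + 2 * B\<^sup>2)"
    using sample_square(1) by simp
  show int: "integrable M (\<lambda>\<omega>. (norm (noise k \<omega>))\<^sup>2)"
    by (rule Bochner_Integration.integrable_bound[OF bound]) (use le in \<open>auto intro!: AE_I2\<close>)
  have "(\<integral>\<omega>. (norm (noise k \<omega>))\<^sup>2 \<partial>M) \<le> (\<integral>\<omega>. 2 * (norm (sample k \<omega>))\<^sup>2 + 2 * B\<^sup>2 \<partial>M)"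
    using le by (intro integral_mono int bound)
  also have "\<dots> = 2 * (\<integral>\<omega>. (norm (sample k \<omega>))\<^sup>2 \<partial>M) + 2 * B\<^sup>2"
    using sample_square(1) by (simp add: prob_space)
  finally show "(\<integral>\<omega>. (norm (noise k \<omega>))\<^sup>2 \<partial>M) \<le> 2 * C\<^sup>2 + 2 * B\<^sup>2"
    using sample_square(2)[of k] by simp
qed

text \<open>The martingale difference property: with the iterates frozen, the noise averages to zero
  because \<open>F\<close> is the mean of \<open>\<Phi>\<close>, while
  \<open>x k \<omega> - shadow k \<omega>\<close> is fixed by the past.\<close>

lemma noise_inner:
  assumes B: "\<And>y. y \<in> X \<Longrightarrow> norm (F y) \<le> B"
  shows "integrable M (\<lambda>\<omega>. noise k \<omega> \<bullet> (x k \<omega> - shadow k \<omega>))"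
    "(\<integral>\<omega>. noise k \<omega> \<bullet> (x k \<omega> - shadow k \<omega>) \<partial>M) = 0"
proof -
  obtain R where R: "\<And>y. y \<in> X \<Longrightarrow> norm y \<le> R" using X(2) by (auto simp: bounded_iff)
  show int: "integrable M (\<lambda>\<omega>. noise k \<omega> \<bullet> (x k \<omega> - shadow k \<omega>))"
  proof (rule Bochner_Integration.integrable_bound)
    show "integrable M (\<lambda>\<omega>. (norm (noise k \<omega>))\<^sup>2 + (2 * R)\<^sup>2)"
      using noise_square(1)[OF B] by simp
    have "\<bar>noise k \<omega> \<bullet> (x k \<omega> - shadow k \<omega>)\<bar> \<le> (norm (noise k \<omega>))\<^sup>2 + (2 * R)\<^sup>2"
      if "\<omega> \<in> space M" for \<omega>
    proof -
      have *: "norm (x k \<omega> - shadow k \<omega>) \<le> 2 * R"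
        using norm_triangle_ineq4[of "x k \<omega>" "shadow k \<omega>"] R iterates_in[OF that]
        by (smt (verit))
      have "\<bar>noise k \<omega> \<bullet> (x k \<omega> - shadow k \<omega>)\<bar> \<le> norm (noise k \<omega>) * norm (x k \<omega> - shadow k \<omega>)"
        by (rule Cauchy_Schwarz_ineq2)
      also have "\<dots> \<le> norm (noise k \<omega>) * (2 * R)"
        using * by (rule mult_left_mono) simp
      also have "\<dots> \<le> (norm (noise k \<omega>))\<^sup>2 + (2 * R)\<^sup>2"
        using sum_squares_bound[of "norm (noise k \<omega>)" "2 * R"] * norm_ge_zero[of "noise k \<omega>"]
          norm_ge_zero[of "x k \<omega> - shadow k \<omega>"] mult_nonneg_nonneg[of "norm (noise k \<omega>)" "2 * R"]
        by linarith
      finally show ?thesis .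
    qed
    then show "AE \<omega> in M. norm (noise k \<omega> \<bullet> (x k \<omega> - shadow k \<omega>)) \<le> norm ((norm (noise k \<omega>))\<^sup>2 + (2 * R)\<^sup>2)"
      by (intro AE_I2) simp
  qed measurable
  have m: "(\<lambda>((y, u), z). (\<Phi> y z - F y) \<bullet> (y - u)) \<in>
      borel_measurable ((restrict_space borel X \<Otimes>\<^sub>M restrict_space borel X) \<Otimes>\<^sub>M borel)"
  proof -
    have [measurable]: "(\<lambda>y. y) \<in> borel_measurable (restrict_space borel X)"
      by (rule measurable_restrict_space1) simp
    show ?thesis unfolding case_prod_beta by measurable
  qed
  have "(\<integral>\<omega>. noise k \<omega> \<bullet> (x k \<omega> - shadow k \<omega>) \<partial>M) =
      (\<integral>\<omega>. \<integral>\<omega>'. (\<Phi> (x k \<omega>) (\<xi>s k \<omega>') - F (x k \<omega>)) \<bullet> (x k \<omega> - shadow k \<omega>) \<partial>M \<partial>M)"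
    using integral_indep_rvs[OF iterates_indep m] int by simp
  also have "\<dots> = (\<integral>\<omega>. 0 \<partial>M)"
  proof (rule Bochner_Integration.integral_cong[OF refl])
    fix \<omega> assume "\<omega> \<in> space M"
    then have y: "x k \<omega> \<in> X" using iterates_in by blast
    have "(\<lambda>z. (\<Phi> (x k \<omega>) z - F (x k \<omega>)) \<bullet> (x k \<omega> - shadow k \<omega>)) \<in> borel_measurable borel"
      using \<Phi>_borel[OF y] by simp
    from integral_\<xi>s[OF this]
    have "(\<integral>\<omega>'. (\<Phi> (x k \<omega>) (\<xi>s k \<omega>') - F (x k \<omega>)) \<bullet> (x k \<omega> - shadow k \<omega>) \<partial>M) =
        (\<integral>\<omega>'. (\<Phi> (x k \<omega>) (\<xi> \<omega>') - F (x k \<omega>)) \<bullet> (x k \<omega> - shadow k \<omega>) \<partial>M)" .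
    also have "\<dots> = 0"
      using \<Phi>_integrable[OF y] F[OF y] by (simp add: prob_space)
    finally show "(\<integral>\<omega>'. (\<Phi> (x k \<omega>) (\<xi>s k \<omega>') - F (x k \<omega>)) \<bullet> (x k \<omega> - shadow k \<omega>) \<partial>M) = 0" .
  qed
  finally show "(\<integral>\<omega>. noise k \<omega> \<bullet> (x k \<omega> - shadow k \<omega>) \<partial>M) = 0" by simp
qed

section \<open>Bounds for the gap of the average\<close>

text \<open>Two projection inequalities are added, one for the iterates and one for the shadow
  sequence. On the right, \<open>y\<close> survives only in differences that telescope.\<close>

lemma step_inequality:
  assumes \<omega>: "\<omega> \<in> space M" and y: "y \<in> X"
  shows "2 * \<gamma> k * (F y \<bullet> (x k \<omega> - y)) \<le>
    ((norm (x k \<omega> - y))\<^sup>2 - (norm (x (Suc k) \<omega> - y))\<^sup>2) +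
    ((norm (shadow k \<omega> - y))\<^sup>2 - (norm (shadow (Suc k) \<omega> - y))\<^sup>2) +
    (\<gamma> k)\<^sup>2 * ((norm (sample k \<omega>))\<^sup>2 + (norm (noise k \<omega>))\<^sup>2) -
    2 * \<gamma> k * (noise k \<omega> \<bullet> (x k \<omega> - shadow k \<omega>))"
proof -
  have "0 \<le> (F (x k \<omega>) - F y) \<bullet> (x k \<omega> - y)"
    using mono iterates_in[OF \<omega>] y by (auto simp: monotone_map_on_def)
  \<comment> \<open>The sample is \<open>F (x k \<omega>)\<close> plus noise, and the noise is
    tested against \<open>x k \<omega> - y\<close> split at the shadow point.\<close>
  then have "F y \<bullet> (x k \<omega> - y) \<le> sample k \<omega> \<bullet> (x k \<omega> - y) -
      noise k \<omega> \<bullet> (x k \<omega> - shadow k \<omega>) - noise k \<omega> \<bullet> (shadow k \<omega> - y)"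
    by (simp add: inner_diff_left inner_diff_right)
  from mult_left_mono[OF this, of "2 * \<gamma> k"]
  have "2 * \<gamma> k * (F y \<bullet> (x k \<omega> - y)) \<le> 2 * \<gamma> k * (sample k \<omega> \<bullet> (x k \<omega> - y)) -
      2 * \<gamma> k * (noise k \<omega> \<bullet> (x k \<omega> - shadow k \<omega>)) - 2 * \<gamma> k * (noise k \<omega> \<bullet> (shadow k \<omega> - y))"
    using \<gamma>(1)[of k] by (simp add: algebra_simps)
  moreover have "(norm (x (Suc k) \<omega> - y))\<^sup>2 \<le> (norm (x k \<omega> - y))\<^sup>2 -
      2 * \<gamma> k * (sample k \<omega> \<bullet> (x k \<omega> - y)) + (\<gamma> k)\<^sup>2 * (norm (sample k \<omega>))\<^sup>2"
    using closest_point_step[OF X(1,3) y] by simp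
  \<comment> \<open>The shadow moves along the negated noise, so the inner product has a plus sign
    here and cancels the last noise term above.\<close>
  moreover have "(norm (shadow (Suc k) \<omega> - y))\<^sup>2 \<le> (norm (shadow k \<omega> - y))\<^sup>2 +
      2 * \<gamma> k * (noise k \<omega> \<bullet> (shadow k \<omega> - y)) + (\<gamma> k)\<^sup>2 * (norm (noise k \<omega>))\<^sup>2"
    using closest_point_step[OF X(1,3) y, of "shadow k \<omega>" "\<gamma> k" "- noise k \<omega>"]
    unfolding shadow.simps norm_minus_cancel inner_minus_left by linarith
  ultimately show ?thesis unfolding distrib_left by linarith
qed

abbreviation average :: "real \<Rightarrow> nat \<Rightarrow> 'w \<Rightarrow> real ^ 'n" where
  "average \<equiv> aSA_average X \<Phi> \<gamma> \<xi>s x0"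

lemma sum_weights_pos: "0 < n \<Longrightarrow> 0 < (\<Sum>k<n. \<gamma> k powr r)"
proof (rule sum_pos)
  show "0 < \<gamma> k powr r" for k using \<gamma>(1)[of k] by simp
qed auto

lemma average_inner:
  assumes "0 < n"
  shows "(\<Sum>k<n. \<gamma> k powr r) * (v \<bullet> (average r n \<omega> - y)) = (\<Sum>k<n. \<gamma> k powr r * (v \<bullet> (x k \<omega> - y)))"
proof -
  let ?S = "\<Sum>k<n. \<gamma> k powr r"
  have "?S *\<^sub>R (average r n \<omega> - y) = (\<Sum>k<n. \<gamma> k powr r *\<^sub>R x k \<omega>) - ?S *\<^sub>R y"
    using sum_weights_pos[OF assms, of r] by (simp add: aSA_average_def scaleR_right_diff_distrib)
  also have "\<dots> = (\<Sum>k<n. \<gamma> k powr r *\<^sub>R (x k \<omega> - y))"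
    by (simp add: scaleR_right_diff_distrib sum_subtractf scaleR_left.sum)
  finally have "v \<bullet> (?S *\<^sub>R (average r n \<omega> - y)) = v \<bullet> (\<Sum>k<n. \<gamma> k powr r *\<^sub>R (x k \<omega> - y))" by simp
  then show ?thesis by (simp add: inner_sum_right)
qed

lemma average_in:
  assumes "0 < n" "\<omega> \<in> space M"
  shows "average r n \<omega> \<in> X"
proof -
  let ?S = "\<Sum>k<n. \<gamma> k powr r"
  have "(\<Sum>k<n. (\<gamma> k powr r / ?S) *\<^sub>R x k \<omega>) \<in> X"
  proof (rule convex_sum)
    show "(\<Sum>k<n. \<gamma> k powr r / ?S) = 1"
      using sum_weights_pos[OF assms(1), of r] by (simp flip: sum_divide_distrib)
  qed (use X(3) iterates_in[OF assms(2)] in \<open>auto intro!: divide_nonneg_nonneg sum_nonneg\<close>)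
  then show ?thesis
    by (simp add: aSA_average_def scaleR_sum_right divide_inverse mult.commute)
qed

lemma average_borel[measurable]: "average r n \<in> borel_measurable M"
  unfolding aSA_average_def[abs_def] by measurable

text \<open>The bound obtained for a single \<open>y\<close> has a right-hand side free of
  \<open>y\<close>, so it passes to the supremum outcome by outcome.\<close>

lemma gap_average_le:
  assumes \<omega>: "\<omega> \<in> space M" and r: "r \<le> 1"
    and D: "\<And>y z. y \<in> X \<Longrightarrow> z \<in> X \<Longrightarrow> (norm (y - z))\<^sup>2 \<le> D"
  shows "2 * (\<Sum>k<Suc n. \<gamma> k powr r) * gap X F (average r (Suc n) \<omega>) \<le> 2 * D * \<gamma> n powr (r - 1) +
    (\<Sum>k<Suc n. \<gamma> k powr (r + 1) * ((norm (sample k \<omega>))\<^sup>2 + (norm (noise k \<omega>))\<^sup>2) -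
      2 * \<gamma> k powr r * (noise k \<omega> \<bullet> (x k \<omega> - shadow k \<omega>)))"
    (is "2 * ?S * _ \<le> ?rhs")
proof -
  \<comment> \<open>The step inequality carries the weight \<open>\<gamma> k\<close>; the factor
    \<open>c k\<close> turns it into \<open>\<gamma> k powr r\<close>. As \<open>r \<le> 1\<close>
    and the steps do not increase, \<open>c\<close> is nondecreasing, as summation by parts
    requires.\<close>
  define c where "c k = \<gamma> k powr (r - 1)" for k
  have c: "mono c" "0 \<le> c k" for k
    unfolding c_def mono_def using r \<gamma> by (auto intro!: powr_mono2' dest: antimonoD)
  have c\<gamma>: "c k * \<gamma> k = \<gamma> k powr r" "c k * (\<gamma> k)\<^sup>2 = \<gamma> k powr (r + 1)" for k
    using \<gamma>(1)[of k] by (simp_all add: c_def powr_diff powr_add power2_eq_square)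
  have S: "0 < ?S" by (rule sum_weights_pos) simp
  have "F y \<bullet> (average r (Suc n) \<omega> - y) \<le> ?rhs / (2 * ?S)" if y: "y \<in> X" for y
  proof -
    let ?a = "\<lambda>k. (norm (x k \<omega> - y))\<^sup>2" and ?b = "\<lambda>k. (norm (shadow k \<omega> - y))\<^sup>2"
    have "2 * ?S * (F y \<bullet> (average r (Suc n) \<omega> - y)) = 2 * (\<Sum>k<Suc n. \<gamma> k powr r * (F y \<bullet> (x k \<omega> - y)))"
      unfolding mult.assoc average_inner[OF zero_less_Suc] ..
    also have "\<dots> = (\<Sum>k<Suc n. c k * (2 * \<gamma> k * (F y \<bullet> (x k \<omega> - y))))"
      unfolding sum_distrib_left c\<gamma>(1)[symmetric] by (simp only: ac_simps)
    also have "\<dots> \<le> (\<Sum>k<Suc n. c k * ((?a k - ?a (Suc k)) + (?b k - ?b (Suc k)) +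
        (\<gamma> k)\<^sup>2 * ((norm (sample k \<omega>))\<^sup>2 + (norm (noise k \<omega>))\<^sup>2) -
        2 * \<gamma> k * (noise k \<omega> \<bullet> (x k \<omega> - shadow k \<omega>))))"
      by (intro sum_mono mult_left_mono step_inequality \<omega> y c(2))
    also have "\<dots> = (\<Sum>k<Suc n. c k * (?a k - ?a (Suc k))) + (\<Sum>k<Suc n. c k * (?b k - ?b (Suc k))) +
        (\<Sum>k<Suc n. \<gamma> k powr (r + 1) * ((norm (sample k \<omega>))\<^sup>2 + (norm (noise k \<omega>))\<^sup>2) -
          2 * \<gamma> k powr r * (noise k \<omega> \<bullet> (x k \<omega> - shadow k \<omega>)))"
      unfolding sum.distrib[symmetric] c\<gamma>[symmetric]
      by (intro sum.cong refl) (simp only: algebra_simps)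
    \<comment> \<open>The iterates and the shadow sequence each contribute \<open>D * c n\<close>,
      which gives the factor 2 in front of \<open>D\<close>.\<close>
    also have "(\<Sum>k<Suc n. c k * (?a k - ?a (Suc k))) \<le> D * c n"
      by (rule sum_mult_diff_le) (use c D iterates_in[OF \<omega>] y in auto)
    also have "(\<Sum>k<Suc n. c k * (?b k - ?b (Suc k))) \<le> D * c n"
      by (rule sum_mult_diff_le) (use c D iterates_in[OF \<omega>] y in auto)
    finally have "2 * ?S * (F y \<bullet> (average r (Suc n) \<omega> - y)) \<le> ?rhs"
      by (simp add: c_def)
    then show ?thesis using S by (simp add: le_divide_eq mult.commute mult.left_commute del: sum.lessThan_Suc)
  qed
  then have "gap X F (average r (Suc n) \<omega>) \<le> ?rhs / (2 * ?S)"
    by (rule gap_le[OF X(4)])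
  then show ?thesis using S by (simp add: le_divide_eq mult.commute mult.left_commute del: sum.lessThan_Suc)
qed

text \<open>On \<open>X\<close> the gap lies between 0 and its value at a fixed point plus a
  Lipschitz term, hence is bounded.\<close>

lemma gap_average_integrable:
  assumes "0 < n" and B: "\<And>y. y \<in> X \<Longrightarrow> norm (F y) \<le> B"
  shows "integrable M (\<lambda>\<omega>. gap X F (average r n \<omega>))"
proof -
  obtain z where z: "z \<in> X" using X(4) by blast
  obtain R where R: "\<And>y. y \<in> X \<Longrightarrow> norm y \<le> R" using X(2) by (auto simp: bounded_iff)
  have "0 \<le> B" using B[OF z] norm_ge_zero order_trans by blast
  have "gap X F y \<le> gap X F z + B * (2 * R)" if "y \<in> X" for y
  proof -
    have "norm (y - z) \<le> 2 * R" using norm_triangle_ineq4[of y z] R[OF that] R[OF z] by simp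
    then have "B * norm (y - z) \<le> B * (2 * R)" using \<open>0 \<le> B\<close> by (rule mult_left_mono)
    then show ?thesis using gap_diff_le[of X F B y z] X B by fastforce
  qed
  moreover have "(\<lambda>\<omega>. gap X F (average r n \<omega>)) \<in> borel_measurable M"
    by (rule borel_measurable_continuous_on[OF continuous_on_gap[of X F B]]) (use X B in auto)
  ultimately show ?thesis
    using average_in[OF assms(1)] gap_nonneg[of X F B] X(2) B
    by (intro integrable_const_bound[where B = "gap X F z + B * (2 * R)"] AE_I2) auto
qed

text \<open>Expectation removes the inner product term. The constant adds \<open>C\<^sup>2\<close>
  from the sample to \<open>2 * C\<^sup>2 + 2 * B\<^sup>2\<close> from the noise.\<close>

lemma expected_gap_le:
  assumes r: "r \<le> 1" and B: "\<And>y. y \<in> X \<Longrightarrow> norm (F y) \<le> B"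
    and D: "\<And>y z. y \<in> X \<Longrightarrow> z \<in> X \<Longrightarrow> (norm (y - z))\<^sup>2 \<le> D"
  shows "(\<integral>\<omega>. gap X F (average r (Suc n) \<omega>) \<partial>M) \<le>
    (2 * D * \<gamma> n powr (r - 1) + (3 * C\<^sup>2 + 2 * B\<^sup>2) * (\<Sum>k<Suc n. \<gamma> k powr (r + 1))) /
    (2 * (\<Sum>k<Suc n. \<gamma> k powr r))"
proof -
  let ?S = "\<Sum>k<Suc n. \<gamma> k powr r"
  let ?q = "\<lambda>k \<omega>. \<gamma> k powr (r + 1) * ((norm (sample k \<omega>))\<^sup>2 + (norm (noise k \<omega>))\<^sup>2) -
    2 * \<gamma> k powr r * (noise k \<omega> \<bullet> (x k \<omega> - shadow k \<omega>))"
  note int = sample_square(1) noise_square(1)[OF B] noise_inner(1)[OF B]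
  have q: "integrable M (?q k)" for k
    by (intro Bochner_Integration.integrable_diff Bochner_Integration.integrable_add integrable_mult_right int)
  have Eq: "(\<integral>\<omega>. ?q k \<omega> \<partial>M) \<le> (3 * C\<^sup>2 + 2 * B\<^sup>2) * \<gamma> k powr (r + 1)" for k
  proof -
    have "(\<integral>\<omega>. ?q k \<omega> \<partial>M) = \<gamma> k powr (r + 1) *
        ((\<integral>\<omega>. (norm (sample k \<omega>))\<^sup>2 \<partial>M) + (\<integral>\<omega>. (norm (noise k \<omega>))\<^sup>2 \<partial>M))"
      using int noise_inner(2)[OF B] by simp
    also have "\<dots> \<le> \<gamma> k powr (r + 1) * (C\<^sup>2 + (2 * C\<^sup>2 + 2 * B\<^sup>2))"
      by (intro mult_left_mono add_mono sample_square(2) noise_square(2)[OF B]) auto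
    finally show ?thesis by (simp add: algebra_simps)
  qed
  have gap: "integrable M (\<lambda>\<omega>. gap X F (average r (Suc n) \<omega>))"
    by (rule gap_average_integrable[OF zero_less_Suc B])
  have S: "0 < ?S" by (rule sum_weights_pos) simp
  have "2 * ?S * (\<integral>\<omega>. gap X F (average r (Suc n) \<omega>) \<partial>M) =
      (\<integral>\<omega>. 2 * ?S * gap X F (average r (Suc n) \<omega>) \<partial>M)"
    by (simp only: integral_mult_right_zero)
  also have "\<dots> \<le> (\<integral>\<omega>. 2 * D * \<gamma> n powr (r - 1) + (\<Sum>k<Suc n. ?q k \<omega>) \<partial>M)"
    by (intro integral_mono gap_average_le r D integrable_mult_right gap
        Bochner_Integration.integrable_add Bochner_Integration.integrable_sum q) auto
  also have "\<dots> = 2 * D * \<gamma> n powr (r - 1) + (\<Sum>k<Suc n. \<integral>\<omega>. ?q k \<omega> \<partial>M)"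
    using q by (simp add: prob_space del: sum.lessThan_Suc)
  also have "\<dots> \<le> 2 * D * \<gamma> n powr (r - 1) + (3 * C\<^sup>2 + 2 * B\<^sup>2) * (\<Sum>k<Suc n. \<gamma> k powr (r + 1))"
    unfolding sum_distrib_left by (intro add_left_mono sum_mono Eq)
  finally show ?thesis
    using S by (simp add: le_divide_eq mult.commute mult.left_commute del: sum.lessThan_Suc)
qed

end

section \<open>Rates for steps proportional to \<open>1 / sqrt (k + 1)\<close>\<close>

text \<open>With \<open>N = n + 1\<close> the numerator is at most of order
  \<open>b n * N powr ((1 - r) / 2)\<close> and the denominator at least of order
  \<open>N powr (1 - r / 2)\<close>. The factor \<open>b\<close> lets one argument serve both the
  logarithm at \<open>r = 1\<close> and a constant for \<open>r < 1\<close>.\<close>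

lemma sqrt_steps_rate:
  fixes \<gamma> :: "nat \<Rightarrow> real" and c :: real
  assumes \<gamma>: "0 < c" "\<And>k. \<gamma> k = c / sqrt (real k + 1)" and r: "r \<le> 1"
    and K: "0 \<le> K" "0 \<le> L"
    and T: "\<And>n. (\<Sum>k<Suc n. (real k + 1) powr (- (r + 1) / 2)) \<le> b n * real (Suc n) powr ((1 - r) / 2)"
    and b: "\<And>n. 1 \<le> b n"
  obtains A where "0 \<le> A" "\<And>n. (K * \<gamma> n powr (r - 1) + L * (\<Sum>k<Suc n. \<gamma> k powr (r + 1))) /
    (2 * (\<Sum>k<Suc n. \<gamma> k powr r)) \<le> A * (b n / sqrt (real (Suc n)))"
proof -
  have pow: "\<gamma> k powr s = c powr s * (real k + 1) powr (- s / 2)" for k s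
  proof -
    have "\<gamma> k = c * (real k + 1) powr - (1 / 2)"
      using \<gamma>(2)[of k] powr_half_sqrt[of "real k + 1"]
      by (simp only: powr_minus divide_inverse[of "c"] of_nat_0_le_iff add_nonneg_nonneg zero_le_one simp_thms)
    then show ?thesis using \<gamma>(1) by (simp add: powr_mult powr_powr)
  qed
  \<comment> \<open>The constant of \<open>sum_powr_ge\<close> for the exponent
    \<open>1 - r / 2\<close>, which is positive because \<open>r \<le> 1\<close>.\<close>
  define m where "m = min 1 (1 / (1 - r / 2))"
  define A1 where "A1 = K * c powr (r - 1) + L * c powr (r + 1)"
  define A2 where "A2 = 2 * (c powr r * m)"
  have "0 < m" using r by (simp add: m_def)
  have A1: "0 \<le> A1" and A2: "0 < A2"
    using K \<open>0 < m\<close> \<gamma>(1) by (simp_all add: A1_def A2_def)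
  have "(K * \<gamma> n powr (r - 1) + L * (\<Sum>k<Suc n. \<gamma> k powr (r + 1))) / (2 * (\<Sum>k<Suc n. \<gamma> k powr r))
      \<le> A1 / A2 * (b n / sqrt (real (Suc n)))" for n
  proof -
    let ?N = "real (Suc n)"
    have "\<gamma> n powr (r - 1) = c powr (r - 1) * (1 * ?N powr ((1 - r) / 2))"
      using pow[of n "r - 1"] by (simp only: minus_diff_eq of_nat_Suc add.commute mult_1)
    \<comment> \<open>Since \<open>b n\<close> is at least 1, the boundary term can take the same
      factor as the sum.\<close>
    also have "\<dots> \<le> c powr (r - 1) * (b n * ?N powr ((1 - r) / 2))"
      by (intro mult_left_mono mult_right_mono b) auto
    finally have 1: "K * \<gamma> n powr (r - 1) \<le> K * (c powr (r - 1) * (b n * ?N powr ((1 - r) / 2)))"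
      using K(1) by (rule mult_left_mono)
    have "(\<Sum>k<Suc n. \<gamma> k powr (r + 1)) \<le> c powr (r + 1) * (b n * ?N powr ((1 - r) / 2))"
      unfolding pow sum_distrib_left[symmetric] by (intro mult_left_mono T) simp
    then have 2: "L * (\<Sum>k<Suc n. \<gamma> k powr (r + 1)) \<le> L * (c powr (r + 1) * (b n * ?N powr ((1 - r) / 2)))"
      using K(2) by (rule mult_left_mono)
    have num: "K * \<gamma> n powr (r - 1) + L * (\<Sum>k<Suc n. \<gamma> k powr (r + 1)) \<le> A1 * (b n * ?N powr ((1 - r) / 2))"
      using add_mono[OF 1 2] by (simp only: A1_def algebra_simps)
    have "m * ?N powr (1 - r / 2) \<le> (\<Sum>k<Suc n. (real k + 1) powr (- r / 2))"
      using sum_powr_ge[of "1 - r / 2" "Suc n"] r unfolding m_def by simp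
    then have "c powr r * (m * ?N powr (1 - r / 2)) \<le> (\<Sum>k<Suc n. \<gamma> k powr r)"
      unfolding pow sum_distrib_left[symmetric] by (intro mult_left_mono) simp_all
    then have den: "A2 * ?N powr (1 - r / 2) \<le> 2 * (\<Sum>k<Suc n. \<gamma> k powr r)"
      unfolding A2_def by (simp only: mult.assoc)
    have "0 \<le> b n" using b[of n] by simp
    have "(K * \<gamma> n powr (r - 1) + L * (\<Sum>k<Suc n. \<gamma> k powr (r + 1))) / (2 * (\<Sum>k<Suc n. \<gamma> k powr r))
      \<le> (A1 * (b n * ?N powr ((1 - r) / 2))) / (A2 * ?N powr (1 - r / 2))"
      using num den A1 A2 \<open>0 \<le> b n\<close> by (intro frac_le) auto
    \<comment> \<open>Splitting the exponent as \<open>(1 - r) / 2 + 1 / 2\<close> cancels the power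
      in the numerator and leaves the square root.\<close>
    also have "?N powr (1 - r / 2) = ?N powr ((1 - r) / 2) * sqrt ?N"
      unfolding powr_half_sqrt[OF of_nat_0_le_iff, symmetric] powr_add[symmetric]
      by (simp add: diff_divide_distrib)
    finally show ?thesis by simp
  qed
  moreover have "0 \<le> A1 / A2" using A1 A2 by simp
  ultimately show thesis using that by blast
qed

text \<open>The bounds start at \<open>Suc n\<close> because the average with index 0 carries no
  meaning; limit and order ignore that index.\<close>

lemma vanishing_rate:
  fixes e g :: "nat \<Rightarrow> real"
  assumes "\<And>n. 0 \<le> e (Suc n)" "\<And>n. e (Suc n) \<le> A * g (Suc n)" "g \<longlonglongrightarrow> 0" "0 \<le> A"
  shows "e \<longlonglongrightarrow> 0 \<and> e \<in> O(g)"
proof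
  have e: "0 \<le> e n \<and> e n \<le> A * g n" if "1 \<le> n" for n
    using assms(1,2)[of "n - 1"] that by simp
  have "(\<lambda>n. A * g n) \<longlonglongrightarrow> A * 0" by (intro tendsto_intros assms)
  then show "e \<longlonglongrightarrow> 0"
    by (intro tendsto_sandwich[of "\<lambda>_. 0" e sequentially "\<lambda>n. A * g n"] eventually_sequentiallyI[of 1])
      (use e in auto)
  show "e \<in> O(g)"
  proof (rule bigoI, rule eventually_sequentiallyI)
    fix n :: nat assume "1 \<le> n"
    with e have "\<bar>e n\<bar> \<le> A * g n" by simp
    also have "\<dots> \<le> A * \<bar>g n\<bar>" using assms(4) by (intro mult_left_mono) auto
    finally show "norm (e n) \<le> A * norm (g n)" by simp
  qed
qed

lemma one_over_sqrt: "(\<lambda>n. 1 / sqrt (real n)) \<longlonglongrightarrow> 0"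
proof (rule real_tendsto_divide_at_top)
  show "filterlim (\<lambda>n. sqrt (real n)) at_top sequentially"
    by (rule filterlim_compose[OF sqrt_at_top filterlim_real_sequentially])
qed (rule tendsto_const)

lemma ln_over_sqrt:
  "(\<lambda>n. (1 + ln (real n)) / sqrt (real n)) \<longlonglongrightarrow> 0"
  "(\<lambda>n. (1 + ln (real n)) / sqrt (real n)) \<in> O(\<lambda>n. ln (real n) / sqrt (real n))"
proof -
  have "(\<lambda>n. ln (real n) / sqrt (real n)) \<longlonglongrightarrow> 0"
    using lim_ln_over_power[of "1/2"] by (simp add: powr_half_sqrt)
  then show "(\<lambda>n. (1 + ln (real n)) / sqrt (real n)) \<longlonglongrightarrow> 0"
    using tendsto_add[OF one_over_sqrt, of _ 0] by (simp add: add_divide_distrib)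
  show "(\<lambda>n. (1 + ln (real n)) / sqrt (real n)) \<in> O(\<lambda>n. ln (real n) / sqrt (real n))"
  \<comment> \<open>From 3 on, which exceeds the base of the logarithm, \<open>ln n\<close> is at
    least 1, so the added 1 costs only a factor 2.\<close>
  proof (rule bigoI[of _ 2], rule eventually_sequentiallyI[of 3])
    fix n :: nat assume "3 \<le> n"
    then have "1 \<le> ln (real n)"
      using exp_le by (subst ln_ge_iff) auto
    then show "norm ((1 + ln (real n)) / sqrt (real n)) \<le> 2 * norm (ln (real n) / sqrt (real n))"
      by (simp add: divide_right_mono)
  qed
qed

text \<open>The integrability conjunct makes \<open>EG\<close> a true expectation, since the Bochner
  integral of a nonintegrable function defaults to 0.\<close>

theorem proposition7:
  fixes M :: "'w measure"
    and X :: "(real ^ 'n) set"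
    and \<epsilon> C :: real
    and \<Phi> :: "real ^ 'n \<Rightarrow> real ^ 'd \<Rightarrow> real ^ 'n"
    and F :: "real ^ 'n \<Rightarrow> real ^ 'n"
    and \<xi> :: "'w \<Rightarrow> real ^ 'd"
    and \<xi>s :: "nat \<Rightarrow> 'w \<Rightarrow> real ^ 'd"
    and x0 :: "'w \<Rightarrow> real ^ 'n"
    and \<gamma> :: "nat \<Rightarrow> real"
  assumes "prob_space M"
    and "closed X" and "bounded X" and "convex X"
    and "\<epsilon> \<ge> 0"
    and "\<xi> \<in> borel_measurable M"
    and "(\<lambda>(x, z). \<Phi> x z) \<in> borel_measurable (restrict_space borel (enlarge X \<epsilon>) \<Otimes>\<^sub>M borel)"
    and "\<And>x. x \<in> enlarge X \<epsilon> \<Longrightarrow> F x = (\<integral>\<omega>. \<Phi> x (\<xi> \<omega>) \<partial>M)"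
    and "monotone_map_on (enlarge X \<epsilon>) F"
    and "continuous_on (enlarge X \<epsilon>) F"
    and "C > 0"
    and "\<And>x. x \<in> enlarge X \<epsilon> \<Longrightarrow> integrable M (\<lambda>\<omega>. (norm (\<Phi> x (\<xi> \<omega>)))\<^sup>2)"
    and "\<And>x. x \<in> enlarge X \<epsilon> \<Longrightarrow> (\<integral>\<omega>. (norm (\<Phi> x (\<xi> \<omega>)))\<^sup>2 \<partial>M) \<le> C\<^sup>2"
    and "vi_solutions X F \<noteq> {}"
    and "x0 \<in> borel_measurable M"
    and "\<And>\<omega>. \<omega> \<in> space M \<Longrightarrow> x0 \<omega> \<in> X"
    and "integrable M (\<lambda>\<omega>. (norm (x0 \<omega>))\<^sup>2)"
    and "prob_space.indep_vars M (\<lambda>_. borel) \<xi>s UNIV"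
    and "\<And>k. distr M borel (\<xi>s k) = distr M borel \<xi>"
    and "indep_rvs M borel x0 (\<Pi>\<^sub>M k\<in>UNIV. borel) (\<lambda>\<omega> k. \<xi>s k \<omega>)"
    and "\<gamma> 0 > 0"
    and "\<And>k. \<gamma> k = \<gamma> 0 / sqrt (real k + 1)"
  defines "EG \<equiv> (\<lambda>r N. \<integral>\<omega>. gap X F (aSA_average X \<Phi> \<gamma> \<xi>s x0 r N \<omega>) \<partial>M)"
  shows "(\<forall>r\<le>1. \<forall>N\<ge>1. integrable M (\<lambda>\<omega>. gap X F (aSA_average X \<Phi> \<gamma> \<xi>s x0 r N \<omega>)))
       \<and> (\<forall>r. r = 1 \<longrightarrow> EG r \<longlonglongrightarrow> 0 \<and> EG r \<in> O(\<lambda>N. ln (real N) / sqrt (real N)))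
       \<and> (\<forall>r<1. EG r \<longlonglongrightarrow> 0 \<and> EG r \<in> O(\<lambda>N. 1 / sqrt (real N)))"
proof -
  note a = assms(1-22)
  have sub: "X \<subseteq> enlarge X \<epsilon>"
    using \<open>0 \<le> \<epsilon>\<close> unfolding enlarge_def by (force intro: exI[of _ 0])
  have \<gamma>pos: "0 < \<gamma> k" for k
    using a(21) by (subst a(22)) simp
  have "\<gamma> n \<le> \<gamma> m" if "m \<le> n" for m n
    using that a(21) by (subst (1 2) a(22)) (simp add: frac_le)
  then have \<gamma>anti: "antimono \<gamma>" by (rule antimonoI)
  \<comment> \<open>Composition with the inclusion of \<open>X\<close> carries the joint
    measurability of \<open>\<Phi>\<close> from the enlarged set to \<open>X\<close>.\<close>
  have id: "(\<lambda>p. p) \<in> measurable (restrict_space borel X \<Otimes>\<^sub>M borel) (restrict_space borel (enlarge X \<epsilon>) \<Otimes>\<^sub>M borel)"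
  proof -
    have "(\<lambda>y. y) \<in> measurable (restrict_space borel X) (restrict_space borel (enlarge X \<epsilon>))"
      using sub by (intro measurable_restrict_space2 measurable_restrict_space1) (auto simp: space_restrict_space)
    from measurable_Pair[OF measurable_compose[OF measurable_fst this] measurable_snd]
    show ?thesis by simp
  qed
  interpret stochastic_approximation M X C \<Phi> F \<xi> \<xi>s x0 \<gamma>
  proof (intro stochastic_approximation.intro stochastic_approximation_axioms.intro)
    show "X \<noteq> {}" using a(14) by (auto simp: vi_solutions_def)
    show "(\<lambda>(x, z). \<Phi> x z) \<in> borel_measurable (restrict_space borel X \<Otimes>\<^sub>M borel)"
      using measurable_compose[OF id a(7)] by simp
    show "monotone_map_on X F" using a(9) sub by (auto simp: monotone_map_on_def)
    show "continuous_on X F" using a(10) sub continuous_on_subset by blast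
    show "F y = (\<integral>\<omega>. \<Phi> y (\<xi> \<omega>) \<partial>M)" "integrable M (\<lambda>\<omega>. (norm (\<Phi> y (\<xi> \<omega>)))\<^sup>2)"
      "(\<integral>\<omega>. (norm (\<Phi> y (\<xi> \<omega>)))\<^sup>2 \<partial>M) \<le> C\<^sup>2" if "y \<in> X" for y
      using a(8,12,13) sub that by blast+
  qed (fact a \<gamma>pos \<gamma>anti)+
  have "bounded (F ` X)"
    using X compact_imp_bounded[OF compact_continuous_image[OF cont]] by (simp add: compact_eq_bounded_closed)
  then obtain B where B: "\<And>y. y \<in> X \<Longrightarrow> norm (F y) \<le> B"
    unfolding bounded_iff by auto
  obtain d where d: "\<And>y z. y \<in> X \<Longrightarrow> z \<in> X \<Longrightarrow> dist y z \<le> d"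
    using X(2) unfolding bounded_two_points by auto
  define D where "D = d\<^sup>2"
  have D: "(norm (y - z))\<^sup>2 \<le> D" if "y \<in> X" "z \<in> X" for y z
    unfolding D_def using d[OF that] by (intro power_mono) (simp_all add: dist_norm)
  have "0 \<le> D" by (simp add: D_def)
  have nonneg: "0 \<le> EG r (Suc n)" for r n
    unfolding EG_def using average_in gap_nonneg[of X F B] X(2) B by (intro Bochner_Integration.integral_nonneg_AE AE_I2) auto
  \<comment> \<open>The average with index \<open>Suc n\<close> uses the steps 0 to
    \<open>n\<close>, so \<open>\<gamma> n\<close> is the last one.\<close>
  have le: "EG r (Suc n) \<le>
      (2 * D * \<gamma> n powr (r - 1) + (3 * C\<^sup>2 + 2 * B\<^sup>2) * (\<Sum>k<Suc n. \<gamma> k powr (r + 1))) /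
      (2 * (\<Sum>k<Suc n. \<gamma> k powr r))" if "r \<le> 1" for r n
    unfolding EG_def by (rule expected_gap_le[OF that B D])
  have K: "0 \<le> 2 * D" "0 \<le> 3 * C\<^sup>2 + 2 * B\<^sup>2" using \<open>0 \<le> D\<close> by auto
  show ?thesis
  proof (intro conjI allI impI)
    show "integrable M (\<lambda>\<omega>. gap X F (average r N \<omega>))" if "1 \<le> N" for r N
      by (rule gap_average_integrable[OF _ B]) (use that in auto)
  next
    fix r :: real assume r: "r = 1"
    let ?g = "\<lambda>n. (1 + ln (real n)) / sqrt (real n)"
    obtain A where A: "0 \<le> A" "\<And>n. (2 * D * \<gamma> n powr (r - 1) + (3 * C\<^sup>2 + 2 * B\<^sup>2) * (\<Sum>k<Suc n. \<gamma> k powr (r + 1))) /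
        (2 * (\<Sum>k<Suc n. \<gamma> k powr r)) \<le> A * ?g (Suc n)"
    \<comment> \<open>At \<open>r = 1\<close> the exponent in the sum is -1 and the one on the right
      is 0, so the harmonic sum supplies the logarithm.\<close>
    proof (rule sqrt_steps_rate[OF a(21,22) _ K, of r "\<lambda>n. 1 + ln (real (Suc n))"])
      show "(\<Sum>k<Suc n. (real k + 1) powr (- (r + 1) / 2)) \<le>
          (1 + ln (real (Suc n))) * real (Suc n) powr ((1 - r) / 2)" for n
        using sum_inverse_le_ln[of "Suc n"] by (simp add: r powr_minus_divide del: sum.lessThan_Suc)
    qed (use r in auto)
    from vanishing_rate[OF nonneg order_trans[OF le A(2)] ln_over_sqrt(1) A(1)] r
    have "EG r \<longlonglongrightarrow> 0" "EG r \<in> O(?g)" by auto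
    then show "EG r \<longlonglongrightarrow> 0" "EG r \<in> O(\<lambda>N. ln (real N) / sqrt (real N))"
      using landau_o.big_trans[OF _ ln_over_sqrt(2)] by auto
  next
    fix r :: real assume r: "r < 1"
    \<comment> \<open>Positive because \<open>r < 1\<close>. The summands have exponent
      \<open>q - 1\<close>, so \<open>sum_powr_le\<close> supplies a constant depending only on
      \<open>r\<close>.\<close>
    define q where "q = (1 - r) / 2"
    obtain A where A: "0 \<le> A" "\<And>n. (2 * D * \<gamma> n powr (r - 1) + (3 * C\<^sup>2 + 2 * B\<^sup>2) * (\<Sum>k<Suc n. \<gamma> k powr (r + 1))) /
        (2 * (\<Sum>k<Suc n. \<gamma> k powr r)) \<le> A * (max 1 (1 / q) / sqrt (real (Suc n)))"
    proof (rule sqrt_steps_rate[OF a(21,22) _ K, of r "\<lambda>_. max 1 (1 / q)"])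
      have "- (r + 1) / 2 = q - 1" by (simp add: q_def field_simps)
      then show "(\<Sum>k<Suc n. (real k + 1) powr (- (r + 1) / 2)) \<le>
          max 1 (1 / q) * real (Suc n) powr ((1 - r) / 2)" for n
        using sum_powr_le[of q "Suc n"] r by (simp only: q_def[symmetric]) (simp add: q_def)
    qed (use r in auto)
    have "EG r (Suc n) \<le> A * max 1 (1 / q) * (1 / sqrt (real (Suc n)))" for n
      using order_trans[OF le A(2)] r by simp
    from vanishing_rate[OF nonneg this one_over_sqrt] A(1)
    show "EG r \<longlonglongrightarrow> 0" "EG r \<in> O(\<lambda>N. 1 / sqrt (real N))" by auto
  qed
qed

end
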